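(* Let $X$ be a complete, quasiconvex metric space, let $d \geq 1$ be a real number, and assume that $Y \subset X$ satisfies $\overline{\dim}_{\rm box}(Y) < d$. Then $Y$ can be covered by a $\frac{1}{d}$-Hölder curve, i.e. there is a $\frac1d$-Hölder map $f : [0,1] \to X$ with $Y \subset f([0,1])$.
   Context: Metric spaces are nonempty. A metric space $(X,d_X)$ is called quasiconvex if there is a constant $C_X \geq 1$ such that any two points $x,y \in X$ can be connected by a path $\gamma : [0,1] \to X$ of length $\ell(\gamma) \leq C_X d_X(x,y)$. For a set $S$ in a metric space and $\epsilon > 0$, $N(S,\epsilon)$ denotes the minimal number of balls of radius $\epsilon$ needed to cover $S$ ($N(S,\epsilon) = \infty$ if no finite cover exists). The upper box-counting dimension of $S$ is \[ \overline{\dim}_{\rm box}(S) := \limsup_{\epsilon \downarrow 0} \frac{\log N(S,\epsilon)}{-\log \epsilon} . \] For $0 < \alpha \leq 1$, a map $f : [0,1] \to X$ is $\alpha$-Hölder if there is a constant $L \geq 0$ with $d_X(f(s),f(t)) \leq L|s-t|^\alpha$ for all $s,t \in [0,1]$. Such a map is called an $\alpha$-Hölder curve in $X$. *)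

theory Defs
  imports "HOL-Analysis.Analysis"
begin

text \<open>
  Metric spaces are rendered as nonempty subsets \<open>X\<close> of a type of class \<open>metric_space\<close>, with the
  restricted distance; \<open>X = UNIV\<close> gives a whole type.
\<close>

(* The partition t_0 <= ... <= t_n is a sorted list. The supremum is taken in ereal, so
   non-rectifiable curves have length \<infinity>; the empty list contributes 0. *)
definition curve_length :: "(real \<Rightarrow> 'a::metric_space) \<Rightarrow> ereal" where
  "curve_length \<gamma> =
     (SUP ts\<in>{ts. sorted ts \<and> set ts \<subseteq> {0..1}}.
        ereal (\<Sum>i<length ts - 1. dist (\<gamma> (ts ! i)) (\<gamma> (ts ! Suc i))))"

definition quasiconvex :: "'a::metric_space set \<Rightarrow> bool" where
  "quasiconvex X \<longleftrightarrow>
     (\<exists>C\<ge>1. \<forall>x\<in>X. \<forall>y\<in>X. \<exists>\<gamma>. path \<gamma> \<and> path_image \<gamma> \<subseteq> X \<and>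
        pathstart \<gamma> = x \<and> pathfinish \<gamma> = y \<and> curve_length \<gamma> \<le> ereal (C * dist x y))"

(* The balls are open with centres in X, not necessarily in S. For S \<subseteq> X the part of a ball
   outside X is irrelevant, so these are the balls of the metric space X. The infimum of the
   empty set in enat is \<infinity>. *)
definition covering_number :: "'a::metric_space set \<Rightarrow> 'a set \<Rightarrow> real \<Rightarrow> enat" where
  "covering_number X S \<epsilon> =
     (INF F\<in>{F. finite F \<and> F \<subseteq> X \<and> S \<subseteq> (\<Union>x\<in>F. ball x \<epsilon>)}. enat (card F))"

(* Logarithm with log 0 = -\<infinity>, unlike the library convention ln 0 = 0, and log \<infinity> = \<infinity>. *)
definition ln_enat :: "enat \<Rightarrow> ereal" where
  "ln_enat n = (case n of enat k \<Rightarrow> if k = 0 then -\<infinity> else ereal (ln (real k)) | \<infinity> \<Rightarrow> \<infinity>)"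

definition upper_box_dim :: "'a::metric_space set \<Rightarrow> 'a set \<Rightarrow> ereal" where
  "upper_box_dim X S =
     Limsup (at_right 0) (\<lambda>\<epsilon>::real. ln_enat (covering_number X S \<epsilon>) / ereal (- ln \<epsilon>))"

(* Intended for 0 < \<alpha> \<le> 1. Note that 0 powr \<alpha> = 0. *)
definition holder_on :: "real \<Rightarrow> 'a::metric_space set \<Rightarrow> ('a \<Rightarrow> 'b::metric_space) \<Rightarrow> bool" where
  "holder_on \<alpha> U f \<longleftrightarrow> (\<exists>L\<ge>0. \<forall>s\<in>U. \<forall>t\<in>U. dist (f s) (f t) \<le> L * dist s t powr \<alpha>)"

definition holder_curve :: "real \<Rightarrow> 'a::metric_space set \<Rightarrow> (real \<Rightarrow> 'a) \<Rightarrow> bool" where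
  "holder_curve \<alpha> X f \<longleftrightarrow> f \<in> {0..1} \<rightarrow> X \<and> holder_on \<alpha> {0..1} f"

end

theory Submission
  imports Defs "HOL-Library.List_Lexorder"
begin

text \<open>
  A \<open>1 / d\<close>-Hoelder curve through a set of points is found by assigning to the points parameter
  values \<open>g x\<close> in a bounded set of reals such that \<open>dist (g x) (g y)\<close> is at least a constant times
  \<open>dist x y powr d\<close>. The inverse of \<open>g\<close> is then a \<open>1 / d\<close>-Hoelder map on a set \<open>E\<close> of parameters. By
  completeness of \<open>X\<close> it extends to the closure of \<open>E\<close>, and the gaps of the closure are filled with
  paths whose length is comparable to the distance of their endpoints; since \<open>1 / d \<le> 1\<close>, the result
  is a Hoelder curve (\<open>partial_holder_curve_extends\<close>). The paths have to be run through with bounded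
  speed, so the rectifiable curves that quasiconvexity provides are first reparametrized by arc
  length (\<open>quasiconvex_lipschitz_path\<close>).

  The parameters are assigned to a countable set that has all of \<open>Y\<close> in its closure: the centres
  of covers of \<open>Y\<close> by balls of radius comparable to \<open>2 ^ (- n)\<close>. For some \<open>s < d\<close> the cover at scale
  \<open>n\<close> needs at most a constant times \<open>2 powr (s * n)\<close> balls (\<open>upper_box_dim_less_imp_nets\<close>). The
  centres form a tree, in which the parent of a centre is a nearby centre of the next coarser scale.
  List the nodes in lexicographic order, give each node of level \<open>n\<close> the weight
  \<open>2 powr (- d * n)\<close>, and let \<open>g x\<close> be the total weight of the nodes up to \<open>x\<close>, which is finite as
  \<open>s < d\<close>. If two nodes separate at level \<open>n\<close>, their distance is at most of order \<open>2 ^ (- n)\<close>, while a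
  node of level \<open>n + 1\<close> counts for only one of them, so their parameters differ by at least
  \<open>2 powr (- d * (n + 1))\<close> (\<open>tree_holder_parametrization\<close>). The curve obtained in this way has a compact
  image, so with the centres it contains \<open>Y\<close>.
\<close>

section \<open>Lipschitz paths in quasiconvex sets\<close>

definition polygon_length :: "(real \<Rightarrow> 'a::metric_space) \<Rightarrow> real list \<Rightarrow> real" where
  "polygon_length \<gamma> ts = (\<Sum>i<length ts - 1. dist (\<gamma> (ts ! i)) (\<gamma> (ts ! Suc i)))"

lemma polygon_length_Nil [simp]: "polygon_length \<gamma> [] = 0"
  by (simp add: polygon_length_def)

lemma polygon_length_snoc:
  assumes "ts \<noteq> []"
  shows "polygon_length \<gamma> (ts @ [t]) = polygon_length \<gamma> ts + dist (\<gamma> (last ts)) (\<gamma> t)"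
proof -
  obtain n where n: "length ts = Suc n"
    using assms by (cases ts) auto
  have "(\<Sum>i<n. dist (\<gamma> ((ts @ [t]) ! i)) (\<gamma> ((ts @ [t]) ! Suc i)))
      = (\<Sum>i<n. dist (\<gamma> (ts ! i)) (\<gamma> (ts ! Suc i)))"
    by (rule sum.cong) (auto simp: nth_append n)
  moreover have "last ts = ts ! n"
    using assms n by (simp add: last_conv_nth)
  ultimately show ?thesis
    by (simp add: polygon_length_def n nth_append)
qed

definition arc_length :: "(real \<Rightarrow> 'a::metric_space) \<Rightarrow> real \<Rightarrow> real" where
  "arc_length \<gamma> t = (SUP ts\<in>{ts. sorted ts \<and> set ts \<subseteq> {0..t}}. polygon_length \<gamma> ts)"

lemma polygon_length_le_arc_length:
  assumes "\<And>ts. sorted ts \<Longrightarrow> set ts \<subseteq> {0..1} \<Longrightarrow> polygon_length \<gamma> ts \<le> \<Lambda>"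
    and "t \<le> 1" and "sorted ts" and "set ts \<subseteq> {0..t}"
  shows "polygon_length \<gamma> ts \<le> arc_length \<gamma> t"
  unfolding arc_length_def
proof (rule cSUP_upper)
  have "polygon_length \<gamma> us \<le> \<Lambda>" if "sorted us" "set us \<subseteq> {0..t}" for us
    using assms(1)[of us] that \<open>t \<le> 1\<close> by fastforce
  then show "bdd_above (polygon_length \<gamma> ` {ts. sorted ts \<and> set ts \<subseteq> {0..t}})"
    by (auto intro!: bdd_aboveI2[where M = \<Lambda>])
qed (use assms in auto)

lemma arc_length_le:
  assumes "\<And>ts. sorted ts \<Longrightarrow> set ts \<subseteq> {0..t} \<Longrightarrow> polygon_length \<gamma> ts \<le> c"
  shows "arc_length \<gamma> t \<le> c"
  unfolding arc_length_def
proof (rule cSUP_least)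
  show "{ts. sorted ts \<and> set ts \<subseteq> {0..t}} \<noteq> {}"
    by (auto intro: exI[of _ "[]"])
qed (use assms in auto)

lemma arc_length_increment:
  assumes bound: "\<And>ts. sorted ts \<Longrightarrow> set ts \<subseteq> {0..1} \<Longrightarrow> polygon_length \<gamma> ts \<le> \<Lambda>"
    and "0 \<le> s" "s \<le> t" "t \<le> 1"
  shows "dist (\<gamma> s) (\<gamma> t) \<le> arc_length \<gamma> t - arc_length \<gamma> s"
proof -
  have "arc_length \<gamma> s \<le> arc_length \<gamma> t - dist (\<gamma> s) (\<gamma> t)"
  proof (rule arc_length_le)
    fix ts :: "real list"
    assume ts: "sorted ts" "set ts \<subseteq> {0..s}"
    have "polygon_length \<gamma> ts \<le> polygon_length \<gamma> (ts @ [s])"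
      by (cases "ts = []") (simp_all add: polygon_length_snoc, simp add: polygon_length_def)
    also have "\<dots> + dist (\<gamma> s) (\<gamma> t) = polygon_length \<gamma> ((ts @ [s]) @ [t])"
      by (subst polygon_length_snoc) auto
    also have "\<dots> \<le> arc_length \<gamma> t"
    proof (rule polygon_length_le_arc_length[OF bound \<open>t \<le> 1\<close>])
      show "sorted ((ts @ [s]) @ [t])" "set ((ts @ [s]) @ [t]) \<subseteq> {0..t}"
        using ts assms(2,3) by (force simp: sorted_append)+
    qed
    finally show "polygon_length \<gamma> ts \<le> arc_length \<gamma> t - dist (\<gamma> s) (\<gamma> t)"
      by simp
  qed
  then show ?thesis by simp
qed

text \<open>
  The curve is run through with speed at most \<open>\<Lambda>\<close>: at time \<open>\<sigma>\<close> it is at \<open>\<gamma> (a \<sigma>)\<close>, where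
  \<open>a \<sigma>\<close> is the supremum of the times by which at most the length \<open>\<Lambda> * \<sigma>\<close> has been used, a generalized
  inverse of the arc length. If \<open>a \<sigma> < a \<tau>\<close>, then slightly after \<open>a \<sigma>\<close> more than \<open>\<Lambda> * \<sigma>\<close> has
  been used, and arbitrarily shortly before \<open>a \<tau>\<close> at most \<open>\<Lambda> * \<tau>\<close>. So the arc length between such
  times is at most \<open>\<Lambda> * (\<tau> - \<sigma>)\<close>, and continuity of \<open>\<gamma>\<close> passes this on to the distance of
  \<open>\<gamma> (a \<sigma>)\<close> and \<open>\<gamma> (a \<tau>)\<close>.
\<close>

lemma lipschitz_reparametrization:
  fixes \<gamma> :: "real \<Rightarrow> 'a::metric_space"
  assumes cont: "continuous_on {0..1} \<gamma>"
    and bound: "\<And>ts. sorted ts \<Longrightarrow> set ts \<subseteq> {0..1} \<Longrightarrow> polygon_length \<gamma> ts \<le> \<Lambda>"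
  shows "\<exists>h. h 0 = \<gamma> 0 \<and> h 1 = \<gamma> 1 \<and> h ` {0..1} \<subseteq> \<gamma> ` {0..1} \<and>
           (\<forall>s\<in>{0..1}. \<forall>t\<in>{0..1}. dist (h s) (h t) \<le> \<Lambda> * \<bar>s - t\<bar>)"
proof -
  let ?l = "arc_length \<gamma>"
  define R where "R \<sigma> = {t \<in> {0..1}. ?l t \<le> \<Lambda> * \<sigma>}" for \<sigma>
  define a where "a \<sigma> = Sup (R \<sigma>)" for \<sigma>
  define h where "h \<sigma> = \<gamma> (a \<sigma>)" for \<sigma>
  have \<Lambda>0: "0 \<le> \<Lambda>"
    using bound[of "[]"] by simp
  have l0: "?l 0 \<le> 0"
  proof (rule arc_length_le)
    fix ts :: "real list"
    assume "set ts \<subseteq> {0..0}"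
    then have "ts ! i = 0" if "i < length ts" for i
      using that nth_mem by fastforce
    then have "polygon_length \<gamma> ts = (\<Sum>i<length ts - 1. 0)"
      unfolding polygon_length_def by (intro sum.cong) auto
    then show "polygon_length \<gamma> ts \<le> 0" by simp
  qed
  have l1: "?l 1 \<le> \<Lambda>"
    by (rule arc_length_le) (use bound in auto)
  have R0: "0 \<in> R \<sigma>" if "0 \<le> \<sigma>" for \<sigma>
    using that l0 mult_nonneg_nonneg[OF \<Lambda>0 that] by (auto simp: R_def)
  have bdd: "bdd_above (R \<sigma>)" for \<sigma>
    by (auto simp: R_def bdd_above_def)
  have a01: "a \<sigma> \<in> {0..1}" if "0 \<le> \<sigma>" for \<sigma>
    unfolding a_def using R0[OF that] bdd
    by (auto intro!: cSup_upper cSup_least simp: R_def)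
  have below: "\<exists>t\<in>R \<sigma>. t \<le> a \<sigma> \<and> a \<sigma> - e < t" if "0 \<le> \<sigma>" "0 < e" for \<sigma> e
    using less_cSupE[of "a \<sigma> - e" "R \<sigma>"] R0[OF that(1)] that(2) cSup_upper[OF _ bdd]
    unfolding a_def by (metis diff_less_eq less_add_same_cancel1 empty_iff)
  have cont': "\<exists>\<delta>>0. \<forall>s\<in>{0..1}. \<bar>s - t\<bar> < \<delta> \<longrightarrow> dist (\<gamma> s) (\<gamma> t) < e"
    if "t \<in> {0..1}" "0 < e" for t e
    using cont that unfolding continuous_on_iff dist_real_def by blast
  have lip: "dist (h \<sigma>) (h \<tau>) \<le> \<Lambda> * (\<tau> - \<sigma>)" if \<sigma>\<tau>: "0 \<le> \<sigma>" "\<sigma> \<le> \<tau>" for \<sigma> \<tau>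
  proof (cases "a \<sigma> = a \<tau>")
    case True
    then show ?thesis using \<Lambda>0 \<sigma>\<tau> by (simp add: h_def)
  next
    case False
    have "R \<sigma> \<subseteq> R \<tau>"
      using \<sigma>\<tau> \<Lambda>0 by (auto simp: R_def intro: order_trans mult_left_mono)
    then have "a \<sigma> \<le> a \<tau>"
      unfolding a_def using R0[OF \<sigma>\<tau>(1)] bdd by (intro cSup_subset_mono) auto
    with False have less: "a \<sigma> < a \<tau>" by simp
    have \<tau>0: "0 \<le> \<tau>" using \<sigma>\<tau> by simp
    show ?thesis
    proof (rule field_le_epsilon)
      fix e :: real
      assume "0 < e"
      then have e2: "0 < e / 2" by simp
      obtain \<delta>1 where \<delta>1: "\<delta>1 > 0" "\<And>s. s \<in> {0..1} \<Longrightarrow> \<bar>s - a \<sigma>\<bar> < \<delta>1 \<Longrightarrow> dist (\<gamma> s) (\<gamma> (a \<sigma>)) < e / 2"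
        using cont'[OF a01[OF \<sigma>\<tau>(1)] e2] by blast
      obtain \<delta>2 where \<delta>2: "\<delta>2 > 0" "\<And>s. s \<in> {0..1} \<Longrightarrow> \<bar>s - a \<tau>\<bar> < \<delta>2 \<Longrightarrow> dist (\<gamma> s) (\<gamma> (a \<tau>)) < e / 2"
        using cont'[OF a01[OF \<tau>0] e2] by blast
      define m where "m = (a \<sigma> + a \<tau>) / 2"
      define s where "s = min m (a \<sigma> + \<delta>1 / 2)"
      have s: "a \<sigma> < s" "s \<le> m" "\<bar>s - a \<sigma>\<bar> < \<delta>1"
        using less \<delta>1(1) by (auto simp: s_def m_def min_def field_simps abs_if)
      obtain t where t: "t \<in> R \<tau>" "t \<le> a \<tau>" "a \<tau> - min \<delta>2 ((a \<tau> - a \<sigma>) / 2) < t"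
        using below[OF \<tau>0, of "min \<delta>2 ((a \<tau> - a \<sigma>) / 2)"] \<delta>2(1) less by auto
      have st: "s \<le> t" "\<bar>t - a \<tau>\<bar> < \<delta>2"
        using s t less by (auto simp: m_def field_simps min_def split: if_splits)
      have 01: "s \<in> {0..1}" "t \<in> {0..1}"
        using s(1) a01[OF \<sigma>\<tau>(1)] st(1) t(1) by (auto simp: R_def)
      have "s \<notin> R \<sigma>"
        using s(1) cSup_upper[OF _ bdd, of s \<sigma>] unfolding a_def by linarith
      then have "\<Lambda> * \<sigma> < ?l s"
        using 01 by (auto simp: R_def)
      moreover have "?l t \<le> \<Lambda> * \<tau>"
        using t(1) by (auto simp: R_def)
      moreover have "dist (\<gamma> s) (\<gamma> t) \<le> ?l t - ?l s"
        using 01 st by (intro arc_length_increment[OF bound]) auto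
      ultimately have "dist (\<gamma> s) (\<gamma> t) \<le> \<Lambda> * (\<tau> - \<sigma>)"
        by (simp add: algebra_simps)
      moreover have "dist (\<gamma> s) (\<gamma> (a \<sigma>)) < e / 2" "dist (\<gamma> t) (\<gamma> (a \<tau>)) < e / 2"
        using \<delta>1(2)[OF 01(1) s(3)] \<delta>2(2)[OF 01(2) st(2)] by auto
      moreover have "dist (\<gamma> (a \<sigma>)) (\<gamma> (a \<tau>))
          \<le> dist (\<gamma> s) (\<gamma> (a \<sigma>)) + dist (\<gamma> s) (\<gamma> t) + dist (\<gamma> t) (\<gamma> (a \<tau>))"
        by metric
      ultimately show "dist (h \<sigma>) (h \<tau>) \<le> \<Lambda> * (\<tau> - \<sigma>) + e"
        unfolding h_def by linarith
    qed
  qed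
  \<comment> \<open>At most the length \<open>\<Lambda>\<close> is used in total, so the curve is finished at time 1.\<close>
  have "h 1 = \<gamma> 1"
  proof -
    have "1 \<in> R 1" using l1 by (auto simp: R_def)
    then have "1 \<le> a 1"
      unfolding a_def by (rule cSup_upper) (rule bdd)
    then show ?thesis using a01[of 1] by (simp add: h_def)
  qed
  \<comment> \<open>The curve may rest at its starting point up to time \<open>a 0\<close>, but no longer.\<close>
  moreover have "h 0 = \<gamma> 0"
  proof -
    have "dist (\<gamma> (a 0)) (\<gamma> 0) \<le> 0 + e" if e: "0 < e" for e
    proof -
      obtain \<delta> where \<delta>: "\<delta> > 0" "\<And>s. s \<in> {0..1} \<Longrightarrow> \<bar>s - a 0\<bar> < \<delta> \<Longrightarrow> dist (\<gamma> s) (\<gamma> (a 0)) < e"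
        using cont'[OF a01[OF order_refl] e] by blast
      obtain t where t: "t \<in> R 0" "t \<le> a 0" "a 0 - \<delta> < t"
        using below[of 0 \<delta>] \<delta>(1) by auto
      have "dist (\<gamma> 0) (\<gamma> t) \<le> ?l t - ?l 0"
        using t(1) by (intro arc_length_increment[OF bound]) (auto simp: R_def)
      moreover have "0 \<le> ?l 0"
        using polygon_length_le_arc_length[OF bound, of 0 "[]"] by simp
      moreover have "?l t \<le> 0"
        using t(1) by (simp add: R_def)
      ultimately have "dist (\<gamma> 0) (\<gamma> t) \<le> 0"
        by linarith
      then have "\<gamma> t = \<gamma> 0"
        by simp
      then show ?thesis
        using \<delta>(2)[of t] t by (auto simp: R_def dist_commute)
    qed
    then have "dist (\<gamma> (a 0)) (\<gamma> 0) \<le> 0"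
      by (rule field_le_epsilon)
    then show ?thesis by (simp add: h_def)
  qed
  moreover have "h ` {0..1} \<subseteq> \<gamma> ` {0..1}"
    using a01 by (auto simp: h_def)
  moreover have "dist (h s) (h t) \<le> \<Lambda> * \<bar>s - t\<bar>" if "s \<in> {0..1}" "t \<in> {0..1}" for s t
    using lip[of s t] lip[of t s] that
    by (cases "s \<le> t") (auto simp: dist_commute)
  ultimately show ?thesis by blast
qed

lemma quasiconvex_lipschitz_path:
  assumes "quasiconvex X"
  shows "\<exists>C\<ge>0. \<forall>x\<in>X. \<forall>y\<in>X. \<exists>h. h 0 = x \<and> h 1 = y \<and> h ` {0..1::real} \<subseteq> X \<and>
           (\<forall>s\<in>{0..1}. \<forall>t\<in>{0..1}. dist (h s) (h t) \<le> C * dist x y * \<bar>s - t\<bar>)"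
proof -
  obtain C where C: "C \<ge> 1"
    "\<And>x y. x \<in> X \<Longrightarrow> y \<in> X \<Longrightarrow> \<exists>\<gamma>. path \<gamma> \<and> path_image \<gamma> \<subseteq> X \<and> pathstart \<gamma> = x \<and>
       pathfinish \<gamma> = y \<and> curve_length \<gamma> \<le> ereal (C * dist x y)"
    using assms[unfolded quasiconvex_def] by meson
  have "\<exists>h. h 0 = x \<and> h 1 = y \<and> h ` {0..1::real} \<subseteq> X \<and>
      (\<forall>s\<in>{0..1}. \<forall>t\<in>{0..1}. dist (h s) (h t) \<le> C * dist x y * \<bar>s - t\<bar>)"
    if xy: "x \<in> X" "y \<in> X" for x y
  proof -
    obtain \<gamma> where \<gamma>: "path \<gamma>" "path_image \<gamma> \<subseteq> X" "pathstart \<gamma> = x" "pathfinish \<gamma> = y"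
      "curve_length \<gamma> \<le> ereal (C * dist x y)"
      using C(2)[OF xy] by blast
    have "polygon_length \<gamma> ts \<le> C * dist x y" if "sorted ts" "set ts \<subseteq> {0..1}" for ts
    proof -
      have "ereal (polygon_length \<gamma> ts) \<le> curve_length \<gamma>"
        unfolding curve_length_def polygon_length_def using that by (intro SUP_upper) auto
      also note \<gamma>(5)
      finally show ?thesis by simp
    qed
    then have "\<exists>h. h 0 = \<gamma> 0 \<and> h 1 = \<gamma> 1 \<and> h ` {0..1} \<subseteq> \<gamma> ` {0..1} \<and>
        (\<forall>s\<in>{0..1}. \<forall>t\<in>{0..1}. dist (h s) (h t) \<le> C * dist x y * \<bar>s - t\<bar>)"
      using \<gamma>(1) by (intro lipschitz_reparametrization) (auto simp: path_def)
    then show ?thesis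
      using \<gamma>(2-4) unfolding path_image_def pathstart_def pathfinish_def
      by (elim exE conjE) (metis subset_trans)
  qed
  moreover have "0 \<le> C" using C(1) by simp
  ultimately show ?thesis by meson
qed

section \<open>Extension of partially defined Hoelder curves\<close>

lemma holder_imp_uniformly_continuous_on:
  assumes "0 < \<alpha>" "0 \<le> L"
    and hold: "\<And>s t. s \<in> E \<Longrightarrow> t \<in> E \<Longrightarrow> dist (f s) (f t) \<le> L * dist s t powr \<alpha>"
  shows "uniformly_continuous_on E f"
  unfolding uniformly_continuous_on_def
proof (intro allI impI)
  fix e :: real
  assume e: "0 < e"
  define \<delta> where "\<delta> = (e / (L + 1)) powr (1 / \<alpha>)"
  have "dist (f s) (f t) < e" if "s \<in> E" "t \<in> E" "dist s t < \<delta>" for s t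
  proof -
    have "dist s t powr \<alpha> \<le> \<delta> powr \<alpha>"
      using that \<open>0 < \<alpha>\<close> by (intro powr_mono2) auto
    also have "\<dots> = e / (L + 1)"
      using e assms(1,2) by (simp add: \<delta>_def powr_powr)
    finally have "L * dist s t powr \<alpha> \<le> L * (e / (L + 1))"
      using assms(2) by (rule mult_left_mono)
    also have "\<dots> < e"
      using e assms(2) by (simp add: field_simps)
    finally show ?thesis using hold[OF that(1,2)] by linarith
  qed
  moreover have "0 < \<delta>"
    using e assms(2) by (simp add: \<delta>_def)
  ultimately show "\<exists>\<delta>>0. \<forall>x\<in>E. \<forall>x'\<in>E. dist x' x < \<delta> \<longrightarrow> dist (f x') (f x) < e"
    by blast
qed

text \<open>
  A Hoelder map sends Cauchy sequences to Cauchy sequences, so its values along any sequence in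
  \<open>E\<close> that tends to \<open>x\<close> converge in \<open>X\<close>. One such sequence is chosen for each \<open>x\<close>; the Hoelder
  inequality, with the same constant, survives the passage to the limit.
\<close>

lemma holder_extends_to_closure:
  fixes f :: "'b::metric_space \<Rightarrow> 'a::metric_space"
  assumes "complete X" and fX: "\<And>x. x \<in> E \<Longrightarrow> f x \<in> X" and "0 < \<alpha>" "0 \<le> L"
    and hold: "\<And>s t. s \<in> E \<Longrightarrow> t \<in> E \<Longrightarrow> dist (f s) (f t) \<le> L * dist s t powr \<alpha>"
  shows "\<exists>g. (\<forall>x\<in>closure E. g x \<in> X) \<and> (\<forall>x\<in>E. g x = f x) \<and>
           (\<forall>s\<in>closure E. \<forall>t\<in>closure E. dist (g s) (g t) \<le> L * dist s t powr \<alpha>)"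
proof -
  define P where "P x u l \<longleftrightarrow> (\<forall>n. u n \<in> E) \<and> u \<longlonglongrightarrow> x \<and> (\<lambda>n. f (u n)) \<longlonglongrightarrow> l \<and> l \<in> X \<and>
      (x \<in> E \<longrightarrow> l = f x)" for x u l
  have "\<exists>u l. P x u l" if x: "x \<in> closure E" for x
  proof (cases "x \<in> E")
    case True
    then show ?thesis
      using fX unfolding P_def by (intro exI[of _ "\<lambda>_. x"] exI[of _ "f x"]) auto
  next
    case False
    obtain u where u: "\<And>n. u n \<in> E" "u \<longlonglongrightarrow> x"
      using x by (auto simp: closure_sequential)
    have "uniformly_continuous_on E f"
      by (rule holder_imp_uniformly_continuous_on[OF assms(3,4) hold])
    then have "Cauchy (\<lambda>n. f (u n))"
      using uniformly_continuous_imp_Cauchy_continuous[of E f] u LIMSEQ_imp_Cauchy[OF u(2)]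
      unfolding Cauchy_continuous_on_def o_def by blast
    then obtain l where "l \<in> X" "(\<lambda>n. f (u n)) \<longlonglongrightarrow> l"
      using \<open>complete X\<close> fX u(1) unfolding complete_def by metis
    with u False show ?thesis unfolding P_def by blast
  qed
  then obtain u g where "\<And>x. x \<in> closure E \<Longrightarrow> P x (u x) (g x)"
    by metis
  then have
    u: "\<And>x n. x \<in> closure E \<Longrightarrow> u x n \<in> E" "\<And>x. x \<in> closure E \<Longrightarrow> u x \<longlonglongrightarrow> x" and
    g: "\<And>x. x \<in> closure E \<Longrightarrow> (\<lambda>n. f (u x n)) \<longlonglongrightarrow> g x"
       "\<And>x. x \<in> closure E \<Longrightarrow> g x \<in> X" "\<And>x. x \<in> closure E \<Longrightarrow> x \<in> E \<Longrightarrow> g x = f x"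
    unfolding P_def by auto
  have "dist (g s) (g t) \<le> L * dist s t powr \<alpha>" if st: "s \<in> closure E" "t \<in> closure E" for s t
  proof (rule LIMSEQ_le)
    show "(\<lambda>n. dist (f (u s n)) (f (u t n))) \<longlonglongrightarrow> dist (g s) (g t)"
      by (intro tendsto_dist g st)
    show "(\<lambda>n. L * dist (u s n) (u t n) powr \<alpha>) \<longlonglongrightarrow> L * dist s t powr \<alpha>"
      using \<open>0 < \<alpha>\<close> by (intro tendsto_mult tendsto_const tendsto_powr' tendsto_dist u st) auto
    show "\<exists>N. \<forall>n\<ge>N. dist (f (u s n)) (f (u t n)) \<le> L * dist (u s n) (u t n) powr \<alpha>"
      using hold u(1) st by blast
  qed
  moreover have "\<forall>x\<in>E. g x = f x"
    using g(3) closure_subset by blast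
  ultimately show ?thesis
    using g(2) by blast
qed

text \<open>
  Each maximal interval \<open>{u<..<v}\<close> outside \<open>E\<close> is filled by a Lipschitz path from \<open>f u\<close> to \<open>f v\<close>.
  Its length is at most a constant times \<open>(v - u) powr \<alpha>\<close>, so on an interval of length \<open>v - u\<close> its
  speed is of order \<open>(v - u) powr (\<alpha> - 1)\<close>; because \<open>\<alpha> \<le> 1\<close>, this linear bound implies the Hoelder
  bound at all distances up to \<open>v - u\<close>. Two points that are not in a common gap are compared through
  the point of \<open>E\<close> following the first and the point of \<open>E\<close> preceding the second.
\<close>

lemma holder_extends_over_gaps:
  fixes f :: "real \<Rightarrow> 'a::metric_space"
  assumes "quasiconvex X" and "closed E" and pq: "p \<in> E" "q \<in> E" "E \<subseteq> {p..q}"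
    and \<alpha>: "0 < \<alpha>" "\<alpha> \<le> 1" and L: "0 \<le> L"
    and fX: "\<And>x. x \<in> E \<Longrightarrow> f x \<in> X"
    and hold: "\<And>s t. s \<in> E \<Longrightarrow> t \<in> E \<Longrightarrow> dist (f s) (f t) \<le> L * dist s t powr \<alpha>"
  shows "\<exists>F M. 0 \<le> M \<and> (\<forall>x\<in>{p..q}. F x \<in> X) \<and> (\<forall>x\<in>E. F x = f x) \<and>
           (\<forall>s\<in>{p..q}. \<forall>t\<in>{p..q}. dist (F s) (F t) \<le> M * dist s t powr \<alpha>)"
proof -
  define P where "P C x y h \<longleftrightarrow> h 0 = x \<and> h 1 = y \<and> h ` {0..1::real} \<subseteq> X \<and>
      (\<forall>s\<in>{0..1}. \<forall>t\<in>{0..1}. dist (h s) (h t) \<le> C * dist x y * \<bar>s - t\<bar>)" for C x y h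
  obtain C where C: "0 \<le> C" and "\<forall>x\<in>X. \<forall>y\<in>X. \<exists>h. P C x y h"
    using quasiconvex_lipschitz_path[OF assms(1)] unfolding P_def by (elim exE conjE)
  then obtain H where "\<And>x y. x \<in> X \<Longrightarrow> y \<in> X \<Longrightarrow> P C x y (H x y)"
    by metis
  then have
    H0: "\<And>x y. x \<in> X \<Longrightarrow> y \<in> X \<Longrightarrow> H x y 0 = x" and
    H1: "\<And>x y. x \<in> X \<Longrightarrow> y \<in> X \<Longrightarrow> H x y 1 = y" and
    HX: "\<And>x y. x \<in> X \<Longrightarrow> y \<in> X \<Longrightarrow> H x y ` {0..1::real} \<subseteq> X" and
    Hlip: "\<And>x y s t. x \<in> X \<Longrightarrow> y \<in> X \<Longrightarrow> s \<in> {0..1} \<Longrightarrow> t \<in> {0..1} \<Longrightarrow>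
      dist (H x y s) (H x y t) \<le> C * dist x y * \<bar>s - t\<bar>"
    unfolding P_def by blast+
  define lo where "lo t = Sup {e \<in> E. e \<le> t}" for t
  define hi where "hi t = Inf {e \<in> E. t \<le> e}" for t
  have lo: "lo t \<in> E" "lo t \<le> t" "\<And>e. e \<in> E \<Longrightarrow> e \<le> t \<Longrightarrow> e \<le> lo t" if "t \<in> {p..q}" for t
  proof -
    have bdd: "bdd_above {e \<in> E. e \<le> t}" by (auto simp: bdd_above_def)
    moreover have "closed {e \<in> E. e \<le> t}"
      using closed_Int[OF \<open>closed E\<close> closed_atMost[of t]] by (simp add: Int_def)
    moreover have "{e \<in> E. e \<le> t} \<noteq> {}" using that pq(1) by auto
    ultimately have "lo t \<in> {e \<in> E. e \<le> t}"
      unfolding lo_def by (intro closed_contains_Sup)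
    then show "lo t \<in> E" "lo t \<le> t" by auto
    show "e \<le> lo t" if "e \<in> E" "e \<le> t" for e
      unfolding lo_def using that bdd by (intro cSup_upper) auto
  qed
  have hi: "hi t \<in> E" "t \<le> hi t" "\<And>e. e \<in> E \<Longrightarrow> t \<le> e \<Longrightarrow> hi t \<le> e" if "t \<in> {p..q}" for t
  proof -
    have bdd: "bdd_below {e \<in> E. t \<le> e}" by (auto simp: bdd_below_def)
    moreover have "closed {e \<in> E. t \<le> e}"
      using closed_Int[OF \<open>closed E\<close> closed_atLeast[of t]] by (simp add: Int_def)
    moreover have "{e \<in> E. t \<le> e} \<noteq> {}" using that pq(2) by auto
    ultimately have "hi t \<in> {e \<in> E. t \<le> e}"
      unfolding hi_def by (intro closed_contains_Inf)
    then show "hi t \<in> E" "t \<le> hi t" by auto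
    show "hi t \<le> e" if "e \<in> E" "t \<le> e" for e
      unfolding hi_def using that bdd by (intro cInf_lower) auto
  qed
  define G where "G u v t = H (f u) (f v) ((t - u) / (v - u))" for u v t
  \<comment> \<open>For \<open>t \<in> E\<close> the parameter is \<open>0 / 0 = 0\<close>, and the path from \<open>f t\<close> to itself starts at \<open>f t\<close>.\<close>
  define F where "F t = G (lo t) (hi t) t" for t
  have G: "dist (G u v s) (G u v t) \<le> C * L * dist s t powr \<alpha>"
    if uv: "u \<in> E" "v \<in> E" "u < v" and st: "s \<in> {u..v}" "t \<in> {u..v}" for u v s t
  proof -
    define z where "z = \<bar>s - t\<bar> / (v - u)"
    have z: "0 \<le> z" "z \<le> 1"
      using uv st by (auto simp: z_def divide_simps)
    have "dist (G u v s) (G u v t) \<le> C * dist (f u) (f v) * \<bar>(s - u) / (v - u) - (t - u) / (v - u)\<bar>"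
      unfolding G_def using uv st by (intro Hlip fX) (auto simp: divide_simps)
    also have "(s - u) / (v - u) - (t - u) / (v - u) = (s - t) / (v - u)"
      by (simp add: diff_divide_distrib)
    also have "\<bar>(s - t) / (v - u)\<bar> = z"
      using uv by (simp add: z_def)
    also have "C * dist (f u) (f v) * z \<le> C * (L * (v - u) powr \<alpha>) * z powr \<alpha>"
    proof (intro mult_mono)
      show "dist (f u) (f v) \<le> L * (v - u) powr \<alpha>"
        using hold[OF uv(1,2)] uv(3) by (simp add: dist_real_def)
      show "z \<le> z powr \<alpha>"
        using powr_mono'[of \<alpha> 1 z] z \<alpha> by simp
    qed (use C L z in auto)
    also have "\<dots> = C * L * ((v - u) * z) powr \<alpha>"
      using uv z by (simp add: powr_mult)
    also have "(v - u) * z = dist s t"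
      using uv by (simp add: z_def dist_real_def)
    finally show ?thesis .
  qed
  have endpoints: "G u v u = f u" "u < v \<Longrightarrow> G u v v = f v" if "u \<in> E" "v \<in> E" for u v
    using that by (auto simp: G_def H0 H1 fX)
  have F_E: "F t = f t" if "t \<in> E" for t
  proof -
    have "t \<in> {p..q}" using that pq by auto
    then have "lo t = t" "hi t = t"
      using lo[of t] hi[of t] that by (meson order_antisym order_refl)+
    then show ?thesis using that endpoints by (simp add: F_def)
  qed
  have strict: "lo t < t" "t < hi t" if "t \<in> {p..q}" "t \<notin> E" for t
    using lo[OF that(1)] hi[OF that(1)] that(2) by (metis less_eq_real_def)+
  have near_lo: "dist (F t) (f (lo t)) \<le> C * L * dist t (lo t) powr \<alpha>" if t: "t \<in> {p..q}" for t
  proof (cases "t \<in> E")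
    case True
    then have "lo t = t"
      using lo[OF t] by (meson order_antisym order_refl)
    with True show ?thesis using C L by (simp add: F_E)
  next
    case False
    then show ?thesis
      using G[of "lo t" "hi t" t "lo t"] endpoints(1)[of "lo t" "hi t"] strict[OF t False] lo[OF t] hi[OF t]
      by (simp add: F_def)
  qed
  have near_hi: "dist (F t) (f (hi t)) \<le> C * L * dist t (hi t) powr \<alpha>" if t: "t \<in> {p..q}" for t
  proof (cases "t \<in> E")
    case True
    then have "hi t = t"
      using hi[OF t] by (meson order_antisym order_refl)
    with True show ?thesis using C L by (simp add: F_E)
  next
    case False
    then show ?thesis
      using G[of "lo t" "hi t" t "hi t"] endpoints(2)[of "lo t" "hi t"] strict[OF t False] lo[OF t] hi[OF t]
      by (simp add: F_def)
  qed
  define M where "M = (2 * C + 1) * L"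
  have "0 \<le> M" using C L by (simp add: M_def)
  have CLM: "C * L \<le> M"
    using C L by (simp add: M_def algebra_simps)
  have le: "dist (F s) (F t) \<le> M * dist s t powr \<alpha>" if s: "s \<in> {p..q}" and t: "t \<in> {p..q}" and "s \<le> t" for s t
  proof (cases "hi s \<le> t")
    case True
    then have *: "hi s \<le> lo t"
      using lo(3)[OF t hi(1)[OF s]] by simp
    define D where "D = dist s t powr \<alpha>"
    have mono: "dist a b powr \<alpha> \<le> D" if "s \<le> a" "a \<le> b" "b \<le> t" for a b
      unfolding D_def using that \<alpha> by (intro powr_mono2) (auto simp: dist_real_def)
    have "dist (F s) (F t) \<le> dist (F s) (f (hi s)) + dist (f (hi s)) (f (lo t)) + dist (F t) (f (lo t))"
      by metric
    also have "\<dots> \<le> C * L * D + L * D + C * L * D"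
    proof (intro add_mono)
      show "dist (F s) (f (hi s)) \<le> C * L * D"
        using near_hi[OF s] mono[of s "hi s"] hi(2)[OF s] True C L
        by (meson mult_left_mono mult_nonneg_nonneg order_trans order_refl)
      show "dist (F t) (f (lo t)) \<le> C * L * D"
        using near_lo[OF t] mono[of "lo t" t] lo(2)[OF t] hi(2)[OF s] * C L
        by (metis dist_commute mult_left_mono mult_nonneg_nonneg order_trans order_refl)
      show "dist (f (hi s)) (f (lo t)) \<le> L * D"
        using hold[OF hi(1)[OF s] lo(1)[OF t]] mono[OF hi(2)[OF s] * lo(2)[OF t]] L
        by (meson mult_left_mono order_trans)
    qed
    also have "\<dots> = M * D" by (simp add: M_def algebra_simps)
    finally show ?thesis by (simp add: D_def)
  next
    case False
    have "lo t < s"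
      using hi(3)[OF s lo(1)[OF t]] lo(2)[OF t] False by linarith
    then have "lo t = lo s"
      using lo(3)[OF s lo(1)[OF t]] lo(3)[OF t lo(1)[OF s]] lo(2)[OF s] \<open>s \<le> t\<close> by simp
    moreover have "hi t = hi s"
      using hi(3)[OF t hi(1)[OF s]] hi(3)[OF s hi(1)[OF t]] hi(2)[OF t] \<open>s \<le> t\<close> False by simp
    ultimately have "dist (F s) (F t) \<le> C * L * dist s t powr \<alpha>"
      using G[of "lo s" "hi s" s t] lo[OF s] hi[OF s] \<open>s \<le> t\<close> False by (simp add: F_def)
    also have "\<dots> \<le> M * dist s t powr \<alpha>"
      using CLM by (intro mult_right_mono) auto
    finally show ?thesis .
  qed
  have "dist (F s) (F t) \<le> M * dist s t powr \<alpha>" if "s \<in> {p..q}" "t \<in> {p..q}" for s t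
    using le[of s t] le[of t s] that by (cases "s \<le> t") (auto simp: dist_commute)
  moreover have "F t \<in> X" if t: "t \<in> {p..q}" for t
  proof (cases "t \<in> E")
    case False
    have "(t - lo t) / (hi t - lo t) \<in> {0..1}"
      using strict[OF t False] by (auto simp: divide_simps)
    then show ?thesis
      using HX[of "f (lo t)" "f (hi t)"] fX lo(1)[OF t] hi(1)[OF t] unfolding F_def G_def by blast
  qed (simp add: F_E fX)
  ultimately show ?thesis
    using F_E \<open>0 \<le> M\<close> by blast
qed

text \<open>
  In a complete quasiconvex set, constructing a Hoelder curve through given points only requires
  parameter values for these points: the rest of the curve can always be supplied.
\<close>

lemma partial_holder_curve_extends:
  fixes f :: "real \<Rightarrow> 'a::metric_space"
  assumes X: "complete X" "quasiconvex X" and E: "E \<noteq> {}" "bounded E"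
    and \<alpha>: "0 < \<alpha>" "\<alpha> \<le> 1" and L: "0 \<le> L"
    and fX: "\<And>x. x \<in> E \<Longrightarrow> f x \<in> X"
    and hold: "\<And>s t. s \<in> E \<Longrightarrow> t \<in> E \<Longrightarrow> dist (f s) (f t) \<le> L * dist s t powr \<alpha>"
  shows "\<exists>F. holder_curve \<alpha> X F \<and> f ` E \<subseteq> F ` {0..1}"
proof -
  have "\<exists>g. (\<forall>x\<in>closure E. g x \<in> X) \<and> (\<forall>x\<in>E. g x = f x) \<and>
      (\<forall>s\<in>closure E. \<forall>t\<in>closure E. dist (g s) (g t) \<le> L * dist s t powr \<alpha>)"
    by (rule holder_extends_to_closure[OF X(1) _ \<alpha>(1) L]) (use fX hold in auto)
  then obtain g where g: "\<And>x. x \<in> closure E \<Longrightarrow> g x \<in> X" "\<And>x. x \<in> E \<Longrightarrow> g x = f x"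
    "\<And>s t. s \<in> closure E \<Longrightarrow> t \<in> closure E \<Longrightarrow> dist (g s) (g t) \<le> L * dist s t powr \<alpha>"
    by (elim exE conjE) blast
  define p where "p = Inf (closure E)"
  define q where "q = Sup (closure E)"
  have cl: "closed (closure E)" "bounded (closure E)" "closure E \<noteq> {}"
    using E by auto
  then have bdd: "bdd_above (closure E)" "bdd_below (closure E)"
    by (simp_all add: bounded_imp_bdd_above bounded_imp_bdd_below)
  have pq: "p \<in> closure E" "q \<in> closure E" "closure E \<subseteq> {p..q}"
    unfolding p_def q_def using cl bdd
    by (auto intro: closed_contains_Inf closed_contains_Sup cInf_lower cSup_upper)
  have "\<exists>G M. 0 \<le> M \<and> (\<forall>x\<in>{p..q}. G x \<in> X) \<and> (\<forall>x\<in>closure E. G x = g x) \<and>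
      (\<forall>s\<in>{p..q}. \<forall>t\<in>{p..q}. dist (G s) (G t) \<le> M * dist s t powr \<alpha>)"
    by (rule holder_extends_over_gaps[OF X(2) cl(1) pq \<alpha> L]) (use g in auto)
  then obtain G M where G: "0 \<le> M" "\<And>x. x \<in> {p..q} \<Longrightarrow> G x \<in> X" "\<And>x. x \<in> closure E \<Longrightarrow> G x = g x"
    "\<And>s t. s \<in> {p..q} \<Longrightarrow> t \<in> {p..q} \<Longrightarrow> dist (G s) (G t) \<le> M * dist s t powr \<alpha>"
    by (elim exE conjE) blast
  define a where "a \<tau> = p + \<tau> * (q - p)" for \<tau>
  have "p \<le> q" using pq by auto
  then have a: "a \<tau> \<in> {p..q}" if "\<tau> \<in> {0..1}" for \<tau>
    using that mult_left_le_one_le[of "q - p" \<tau>] by (auto simp: a_def)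
  have "dist (G (a s)) (G (a t)) \<le> M * (q - p) powr \<alpha> * dist s t powr \<alpha>"
    if "s \<in> {0..1}" "t \<in> {0..1}" for s t
  proof -
    have "dist (a s) (a t) = \<bar>(s - t) * (q - p)\<bar>"
      by (simp add: a_def dist_real_def algebra_simps)
    also have "\<dots> = (q - p) * dist s t"
      using \<open>p \<le> q\<close> by (simp add: abs_mult dist_real_def)
    finally show ?thesis
      using G(4)[OF a a, OF that] \<open>p \<le> q\<close> by (simp add: powr_mult)
  qed
  then have "holder_curve \<alpha> X (\<lambda>\<tau>. G (a \<tau>))"
    unfolding holder_curve_def holder_on_def using G(1,2) a
    by (auto intro!: exI[of _ "M * (q - p) powr \<alpha>"])
  moreover have "f ` E \<subseteq> (\<lambda>\<tau>. G (a \<tau>)) ` {0..1}"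
  proof
    fix y assume "y \<in> f ` E"
    then obtain x where x: "x \<in> E" "y = f x" by blast
    have xc: "x \<in> closure E" using x(1) closure_subset by blast
    then have "x \<in> {p..q}" using pq(3) by blast
    then have "a ((x - p) / (q - p)) = x" "(x - p) / (q - p) \<in> {0..1}"
      by (auto simp: a_def divide_simps)
    then show "y \<in> (\<lambda>\<tau>. G (a \<tau>)) ` {0..1}"
      using x xc G(3) g(2) by (metis image_eqI)
  qed
  ultimately show ?thesis by blast
qed

section \<open>Hoelder parametrization of trees\<close>

text \<open>
  In the lexicographic order, on the way up from \<open>x\<close> to \<open>y\<close> one enters the branch of \<open>y\<close> that splits
  off from \<open>x\<close>, and its root \<open>u @ [b]\<close> lies strictly after \<open>x\<close>. This includes the case that \<open>x = u\<close>
  is itself an ancestor of \<open>y\<close>.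
\<close>

lemma list_less_branching:
  fixes x y :: "'a::order list"
  assumes "x < y"
  obtains u v b w where "x = u @ v" "y = u @ b # w" "x < u @ [b]" "u @ [b] \<le> y"
proof -
  have le: "u @ [b] \<le> u @ b # w" for u w and b :: 'a
    by (cases w) (auto simp: list_le_def list_less_def lexord_def)
  from assms consider a w where "y = x @ a # w"
    | u a b v w where "a < b" "x = u @ a # v" "y = u @ b # w"
    unfolding list_less_def lexord_def by auto
  then show ?thesis
  proof cases
    case 1
    then show ?thesis
      using le by (intro that[of x "[]" a w]) (auto simp: list_less_def lexord_def)
  next
    case 2
    then show ?thesis
      using le by (intro that[of u "a # v" b w]) (auto simp: list_less_def lexord_def)
  qed
qed

text \<open>
  The lists in \<open>T\<close> are the nodes of a tree, and extending a list means moving to a child. A node of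
  level \<open>n\<close> gets the weight \<open>2 powr (- d * n)\<close>, and \<open>g x\<close> is the total weight of the nodes up to
  \<open>x\<close> in lexicographic order. If \<open>x < y\<close> and \<open>u\<close> is their longest common prefix, then the root of
  the branch of \<open>y\<close> at \<open>u\<close> is counted for \<open>y\<close> and not for \<open>x\<close>, which makes \<open>g y - g x\<close> at least
  its weight. On the other side both \<open>\<phi> x\<close> and \<open>\<phi> y\<close> are within a geometric series, of order
  \<open>2 ^ (- length u)\<close>, of \<open>\<phi> u\<close>. So \<open>g\<close> separates points by at least a multiple of the \<open>d\<close>-th power
  of their distance.
\<close>

lemma tree_holder_parametrization:
  fixes T :: "'b::linorder list set" and \<phi> :: "'b list \<Rightarrow> 'a::metric_space"
    and B d :: real
  assumes prefix: "\<And>u v. u @ v \<in> T \<Longrightarrow> u \<in> T"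
    and step: "\<And>l i. l @ [i] \<in> T \<Longrightarrow> dist (\<phi> (l @ [i])) (\<phi> l) \<le> B * (1 / 2) ^ length l"
    and "0 \<le> B" "0 < d"
    and sum: "(\<lambda>l. (1 / 2) powr (d * length l)) summable_on T"
  shows "\<exists>g :: 'b list \<Rightarrow> real. bounded (g ` T) \<and>
           (\<forall>x\<in>T. \<forall>y\<in>T. dist (\<phi> x) (\<phi> y) \<le> 8 * B * dist (g x) (g y) powr (1 / d))"
proof -
  define w :: "'b list \<Rightarrow> real" where "w l = (1 / 2) powr (d * length l)" for l
  define g where "g x = infsum w {u \<in> T. u \<le> x}" for x
  have w0: "0 \<le> w l" for l by (simp add: w_def)
  have summable: "w summable_on A" if "A \<subseteq> T" for A
    using summable_on_subset_banach[OF sum that] by (simp add: w_def[abs_def])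
  have bounded: "bounded (g ` T)"
  proof (rule boundedI)
    fix r assume "r \<in> g ` T"
    then obtain x where r: "r = g x" by blast
    have "0 \<le> g x"
      unfolding g_def by (rule infsum_nonneg) (rule w0)
    moreover have "g x \<le> infsum w T"
      unfolding g_def by (rule infsum_mono2) (auto intro: summable w0)
    ultimately show "norm r \<le> infsum w T" by (simp add: r)
  qed
  \<comment> \<open>The subtracted term is the tail of the geometric series; it makes the induction go through.\<close>
  have descend: "dist (\<phi> (u @ v)) (\<phi> u) \<le> 2 * B * ((1 / 2) ^ length u - (1 / 2) ^ length (u @ v))"
    if "u @ v \<in> T" for u v
    using that
  proof (induction v rule: rev_induct)
    case (snoc i v)
    have T: "(u @ v) @ [i] \<in> T" using snoc.prems by simp
    have "dist (\<phi> ((u @ v) @ [i])) (\<phi> (u @ v)) \<le> B * (1 / 2) ^ length (u @ v)"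
      by (rule step[OF T])
    moreover have "dist (\<phi> (u @ v)) (\<phi> u) \<le> 2 * B * ((1 / 2) ^ length u - (1 / 2) ^ length (u @ v))"
      by (rule snoc.IH[OF prefix[OF T]])
    moreover have "dist (\<phi> ((u @ v) @ [i])) (\<phi> u)
        \<le> dist (\<phi> ((u @ v) @ [i])) (\<phi> (u @ v)) + dist (\<phi> (u @ v)) (\<phi> u)"
      by (rule dist_triangle)
    ultimately show ?case by (simp add: algebra_simps)
  qed simp
  have descend': "dist (\<phi> (u @ v)) (\<phi> u) \<le> 2 * B * (1 / 2) ^ length u" if "u @ v \<in> T" for u v
  proof -
    have "2 * B * ((1 / 2) ^ length u - (1 / 2) ^ length (u @ v)) \<le> 2 * B * (1 / 2) ^ length u"
      using \<open>0 \<le> B\<close> by (intro mult_left_mono) auto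
    then show ?thesis using descend[OF that] by linarith
  qed
  have less: "dist (\<phi> x) (\<phi> y) \<le> 8 * B * dist (g x) (g y) powr (1 / d)"
    if xy: "x \<in> T" "y \<in> T" "x < y" for x y
  proof -
    obtain u v b v' where u: "x = u @ v" "y = u @ b # v'" "x < u @ [b]" "u @ [b] \<le> y"
      using list_less_branching[OF xy(3)] .
    define z where "z = u @ [b]"
    have z: "z \<in> T" "x < z" "z \<le> y"
      using prefix[of z v'] xy(2) u by (auto simp: z_def)
    have "g x + w z = infsum w (insert z {l \<in> T. l \<le> x})"
      using z(2) unfolding g_def by (subst infsum_insert) (auto intro: summable)
    also have "\<dots> \<le> g y"
      unfolding g_def using z xy by (intro infsum_mono2) (auto intro: summable w0)
    finally have gap: "w z \<le> dist (g x) (g y)"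
      using w0[of z] by (simp add: dist_real_def)
    have "dist (\<phi> x) (\<phi> y) \<le> dist (\<phi> x) (\<phi> u) + dist (\<phi> y) (\<phi> u)"
      by metric
    also have "\<dots> \<le> 2 * B * (1 / 2) ^ length u + 2 * B * (1 / 2) ^ length u"
      using descend'[of u v] descend'[of u "b # v'"] xy(1,2) u(1,2) by (intro add_mono) auto
    also have "\<dots> = 8 * B * (1 / 2) ^ length z"
      by (simp add: z_def)
    also have "(1 / 2) ^ length z = w z powr (1 / d)"
      using \<open>0 < d\<close> by (simp add: w_def powr_powr powr_realpow)
    also have "8 * B * w z powr (1 / d) \<le> 8 * B * dist (g x) (g y) powr (1 / d)"
      using gap w0 \<open>0 \<le> B\<close> \<open>0 < d\<close> by (intro mult_left_mono powr_mono2) auto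
    finally show ?thesis .
  qed
  have "dist (\<phi> x) (\<phi> y) \<le> 8 * B * dist (g x) (g y) powr (1 / d)" if "x \<in> T" "y \<in> T" for x y
    using less[of x y] less[of y x] that \<open>0 \<le> B\<close>
    by (cases x y rule: linorder_cases) (auto simp: dist_commute)
  with bounded show ?thesis by blast
qed

lemma summable_on_levels:
  fixes T :: "'b list set" and K s d :: real
  assumes fin: "\<And>n. finite {l \<in> T. length l = n}"
    and card: "\<And>n. card {l \<in> T. length l = n} \<le> K * (2 powr s) ^ n"
    and "s < d"
  shows "(\<lambda>l. (1 / 2) powr (d * length l)) summable_on T"
proof (rule nonneg_bounded_partial_sums_imp_summable_on)
  define q :: real where "q = 2 powr (s - d)"
  have q: "0 < q" "q < 1"
    using \<open>s < d\<close> powr_less_mono[of "s - d" 0 2] by (auto simp: q_def)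
  have K: "0 \<le> K" using card[of 0] by simp
  show "\<forall>\<^sub>F A in finite_subsets_at_top T. (\<Sum>l\<in>A. (1 / 2) powr (d * length l)) \<le> K * (1 / (1 - q))"
  proof (rule eventually_finite_subsets_at_top_weakI)
    fix A assume A: "finite A" "A \<subseteq> T"
    define M where "M = Max (length ` A)"
    have "length ` A \<subseteq> {..M}" using A(1) by (auto simp: M_def)
    then have "(\<Sum>l\<in>A. (1 / 2) powr (d * length l))
        = (\<Sum>n\<le>M. \<Sum>l | l \<in> A \<and> length l = n. (1 / 2) powr (d * length l))"
      by (intro sum.group[symmetric] A(1)) auto
    also have "\<dots> \<le> (\<Sum>n\<le>M. K * q ^ n)"
    proof (rule sum_mono)
      fix n
      have "(\<Sum>l | l \<in> A \<and> length l = n. (1 / 2) powr (d * length l))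
          = card {l \<in> A. length l = n} * (1 / 2) powr (d * n)"
        by simp
      also have "\<dots> \<le> card {l \<in> T. length l = n} * (1 / 2) powr (d * n)"
        using A(2) by (intro mult_right_mono of_nat_mono card_mono fin) auto
      also have "\<dots> \<le> K * (2 powr s) ^ n * (1 / 2) powr (d * n)"
        by (intro mult_right_mono card) auto
      also have "\<dots> = K * q ^ n"
        by (simp add: q_def powr_divide powr_diff powr_powr[symmetric] powr_realpow power_divide)
      finally show "(\<Sum>l | l \<in> A \<and> length l = n. (1 / 2) powr (d * length l)) \<le> K * q ^ n" .
    qed
    also have "\<dots> = K * (\<Sum>n\<le>M. q ^ n)"
      by (simp add: sum_distrib_left)
    also have "\<dots> \<le> K * (1 / (1 - q))"
      using q K sum_le_suminf[of "\<lambda>n. q ^ n" "{..M}"] by (intro mult_left_mono) (auto simp: suminf_geometric summable_geometric)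
    finally show "(\<Sum>l\<in>A. (1 / 2) powr (d * length l)) \<le> K * (1 / (1 - q))" .
  qed
qed auto

text \<open>
  The list of labels \<open>c\<close> on the way from the root to the node \<open>x\<close> of level \<open>n\<close>, where \<open>p m\<close> maps
  each node of level \<open>m + 1\<close> to its parent in level \<open>m\<close>. The root carries no label, so that all lists
  start in the same place.
\<close>

primrec branch :: "('a \<Rightarrow> nat) \<Rightarrow> (nat \<Rightarrow> 'a \<Rightarrow> 'a) \<Rightarrow> nat \<Rightarrow> 'a \<Rightarrow> nat list" where
  "branch c p 0 x = []"
| "branch c p (Suc n) x = branch c p n (p n x) @ [c x]"

lemma length_branch [simp]: "length (branch c p n x) = n"
  by (induction n arbitrary: x) auto

text \<open>
  Choosing for each point of \<open>F (Suc n)\<close> a point of \<open>F n\<close> nearby as its parent makes the nets the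
  levels of a tree, whose nodes are identified with their branches. Level \<open>n\<close> has at most
  \<open>K * 2 powr (s * n)\<close> nodes of weight \<open>2 powr (- d * n)\<close> each, so \<open>s < d\<close> makes the total weight finite.
  By the inequality for \<open>g\<close>, nodes with the same value of \<open>g\<close> belong to the same point, hence the
  inverse of \<open>g\<close> is well defined as a map to points.
\<close>

lemma nets_holder_parametrization:
  fixes F :: "nat \<Rightarrow> 'a::metric_space set" and K s d B :: real
  assumes F0: "F 0 = {x0}"
    and fin: "\<And>n. finite (F n)" and card: "\<And>n. card (F n) \<le> K * (2 powr s) ^ n"
    and "s < d" "0 < d" "0 \<le> B"
    and parent: "\<And>n x. x \<in> F (Suc n) \<Longrightarrow> \<exists>x'\<in>F n. dist x x' \<le> B * (1 / 2) ^ n"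
  shows "\<exists>(E :: real set) f L. E \<noteq> {} \<and> bounded E \<and> 0 \<le> L \<and> f ` E = (\<Union>n. F n) \<and>
           (\<forall>s\<in>E. \<forall>t\<in>E. dist (f s) (f t) \<le> L * dist s t powr (1 / d))"
proof -
  define p where "p n x = (SOME x'. x' \<in> F n \<and> dist x x' \<le> B * (1 / 2) ^ n)" for n x
  have p: "p n x \<in> F n" and dist_p: "dist x (p n x) \<le> B * (1 / 2) ^ n" if "x \<in> F (Suc n)" for n x
    using someI_ex[OF parent[OF that, unfolded Bex_def]] unfolding p_def by auto
  define D where "D = (\<Union>n. F n)"
  have "countable D"
    unfolding D_def using fin by (simp add: countable_finite)
  then obtain c :: "'a \<Rightarrow> nat" where c: "inj_on c D"
    by (auto simp: countable_def)
  define br where "br = branch c p"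
  define T where "T = (\<Union>n. br n ` F n)"
  define \<phi> where "\<phi> l = (if l = [] then x0 else inv_into D c (last l))" for l
  have \<phi>: "\<phi> (br n x) = x" if "x \<in> F n" for n x
  proof (cases n)
    case 0
    then show ?thesis using that F0 by (simp add: \<phi>_def br_def)
  next
    case (Suc m)
    moreover have "x \<in> D" using that by (auto simp: D_def)
    ultimately show ?thesis using c by (simp add: \<phi>_def br_def)
  qed
  have \<phi>T: "\<phi> ` T = D"
    unfolding T_def D_def using \<phi> by (force simp: image_iff)
  have prefix_aux: "u \<in> T" if "u @ v = br n x" "x \<in> F n" for u v n x
    using that
  proof (induction n arbitrary: v x)
    case 0
    then have "u = br 0 x0" by (simp add: br_def)
    then show ?case using F0 by (auto simp: T_def)
  next
    case (Suc n)
    show ?case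
    proof (cases v rule: rev_cases)
      case Nil
      then show ?thesis using Suc.prems by (auto simp: T_def)
    next
      case (snoc v' z)
      then have "u @ v' = br n (p n x)"
        using Suc.prems(1) by (simp add: br_def flip: append_assoc)
      then show ?thesis using Suc.IH p[OF Suc.prems(2)] by blast
    qed
  qed
  have prefix: "u \<in> T" if "u @ v \<in> T" for u v
    using that prefix_aux unfolding T_def by blast
  have step: "dist (\<phi> (l @ [i])) (\<phi> l) \<le> B * (1 / 2) ^ length l" if "l @ [i] \<in> T" for l i
  proof -
    obtain n x where x: "x \<in> F n" "l @ [i] = br n x"
      using \<open>l @ [i] \<in> T\<close> by (auto simp: T_def)
    then obtain m where n: "n = Suc m"
      by (cases n) (auto simp: br_def)
    have l: "l = br m (p m x)"
      using x(2) by (simp add: n br_def)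
    have "\<phi> l = p m x"
      unfolding l using \<phi> p x(1) n by blast
    moreover have "\<phi> (l @ [i]) = x"
      unfolding x(2) using \<phi> x(1) by blast
    moreover have "length l = m"
      by (simp add: l br_def)
    ultimately show ?thesis
      using dist_p x(1) n by simp
  qed
  have level: "{l \<in> T. length l = n} = br n ` F n" for n
    by (auto simp: T_def br_def)
  have sum: "(\<lambda>l. (1 / 2) powr (d * length l)) summable_on T"
  proof (rule summable_on_levels)
    show "finite {l \<in> T. length l = n}" for n
      using fin by (simp add: level)
    show "card {l \<in> T. length l = n} \<le> K * (2 powr s) ^ n" for n
      unfolding level using card_image_le[OF fin, of "br n" n] card[of n] by linarith
  qed fact
  have "\<exists>g :: nat list \<Rightarrow> real. bounded (g ` T) \<and>
      (\<forall>x\<in>T. \<forall>y\<in>T. dist (\<phi> x) (\<phi> y) \<le> 8 * B * dist (g x) (g y) powr (1 / d))"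
  proof (rule tree_holder_parametrization)
    show "u \<in> T" if "u @ v \<in> T" for u v
      using that by (rule prefix)
  qed (fact step \<open>0 \<le> B\<close> \<open>0 < d\<close> sum)+
  then obtain g :: "nat list \<Rightarrow> real" where g: "bounded (g ` T)"
    "\<And>x y. x \<in> T \<Longrightarrow> y \<in> T \<Longrightarrow> dist (\<phi> x) (\<phi> y) \<le> 8 * B * dist (g x) (g y) powr (1 / d)"
    by (elim exE conjE) blast
  define f where "f e = \<phi> (inv_into T g e)" for e
  have fg: "f (g l) = \<phi> l" if "l \<in> T" for l
  proof -
    have "inv_into T g (g l) \<in> T" "g (inv_into T g (g l)) = g l"
      using that by (auto intro: inv_into_into f_inv_into_f)
    then show ?thesis
      using g(2)[of "inv_into T g (g l)" l] that by (simp add: f_def)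
  qed
  have "f ` g ` T = D"
    unfolding \<phi>T[symmetric] image_image using fg by (rule image_cong[OF refl])
  moreover have "dist (f s) (f t) \<le> 8 * B * dist s t powr (1 / d)" if st: "s \<in> g ` T" "t \<in> g ` T" for s t
  proof -
    obtain x y where "x \<in> T" "s = g x" "y \<in> T" "t = g y"
      using st by blast
    then show ?thesis
      using g(2)[of x y] by (simp add: fg)
  qed
  moreover have "g ` T \<noteq> {}"
    using F0 by (auto simp: T_def)
  moreover have "0 \<le> 8 * B" using \<open>0 \<le> B\<close> by simp
  ultimately have "g ` T \<noteq> {} \<and> bounded (g ` T) \<and> 0 \<le> 8 * B \<and> f ` g ` T = (\<Union>n. F n) \<and>
      (\<forall>s\<in>g ` T. \<forall>t\<in>g ` T. dist (f s) (f t) \<le> 8 * B * dist s t powr (1 / d))"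
    using g(1) unfolding D_def by blast
  then show ?thesis
    by (intro exI[of _ "g ` T"] exI[of _ f] exI[of _ "8 * B"])
qed

section \<open>Nets from the box-counting dimension\<close>

lemma upper_box_dim_less_imp_small_covers:
  assumes "upper_box_dim X Y < ereal s"
  shows "\<forall>\<^sub>F \<epsilon> in at_right 0. \<exists>F. finite F \<and> F \<subseteq> X \<and> Y \<subseteq> (\<Union>x\<in>F. ball x \<epsilon>) \<and> card F \<le> \<epsilon> powr - s"
proof -
  have "\<forall>\<^sub>F \<epsilon>::real in at_right 0. \<epsilon> < 1"
    by (rule order_tendstoD(2)[OF tendsto_ident_at]) simp
  moreover have "\<forall>\<^sub>F \<epsilon>::real in at_right 0. 0 < \<epsilon>"
    by (rule eventually_at_right_less)
  moreover have "\<forall>\<^sub>F \<epsilon> in at_right 0. ln_enat (covering_number X Y \<epsilon>) / ereal (- ln \<epsilon>) < ereal s"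
    using assms unfolding upper_box_dim_def by (rule Limsup_lessD)
  ultimately show ?thesis
  proof eventually_elim
    case (elim \<epsilon>)
    define c where "c = - ln \<epsilon>"
    have c: "0 < c" using elim by (simp add: c_def)
    have lt: "ln_enat (covering_number X Y \<epsilon>) / ereal c < ereal s"
      using elim by (simp add: c_def)
    show ?case
    proof (cases "covering_number X Y \<epsilon>")
      case infinity
      then show ?thesis using lt c by (simp add: ln_enat_def)
    next
      case (enat k)
      then have "covering_number X Y \<epsilon> < enat (Suc k)" by simp
      then obtain F where F: "finite F" "F \<subseteq> X" "Y \<subseteq> (\<Union>x\<in>F. ball x \<epsilon>)" "card F < Suc k"
        unfolding covering_number_def INF_less_iff by auto
      have "real k \<le> \<epsilon> powr - s"
      proof (cases "k = 0")
        case False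
        then have "ln (real k) < s * c"
          using lt c by (simp add: enat ln_enat_def divide_simps)
        then have "real k < exp (s * c)"
          using False by (metis exp_less_mono exp_ln of_nat_0_less_iff neq0_conv)
        then show ?thesis using elim by (simp add: powr_def c_def)
      qed simp
      then show ?thesis using F by (intro exI[of _ F]) auto
    qed
  qed
qed

text \<open>
  A cover by balls with small radius is taken at each scale \<open>r * (1 / 2) ^ n\<close>, where \<open>r\<close> is below the
  threshold at which the counting bound sets in. The balls that miss \<open>Y\<close> are discarded, so that the
  centres of consecutive scales are close to each other. Taking \<open>s\<close> positive makes the bound on the
  number of balls increase with \<open>n\<close>, so that it still holds when a coarser level is added below.
\<close>

lemma upper_box_dim_less_imp_nets:
  assumes "upper_box_dim X Y < ereal d" "0 < d"
  shows "\<exists>s r K G. 0 < s \<and> s < d \<and> 0 < r \<and> (\<forall>n::nat. finite (G n) \<and> G n \<subseteq> X \<and>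
           card (G n) \<le> K * (2 powr s) ^ n \<and> (\<forall>y\<in>Y. \<exists>x\<in>G n. dist x y < r * (1 / 2) ^ n) \<and>
           (\<forall>x\<in>G n. \<exists>y\<in>Y. dist x y < r * (1 / 2) ^ n))"
proof -
  have "max (upper_box_dim X Y) 0 < ereal d"
    using assms by (simp add: zero_ereal_def)
  then obtain s where "max (upper_box_dim X Y) 0 < ereal s" "ereal s < ereal d"
    using ereal_dense2 by blast
  then have s: "upper_box_dim X Y < ereal s" "0 < s" "s < d"
    by auto
  obtain b where b: "0 < b" "\<And>\<epsilon>. 0 < \<epsilon> \<Longrightarrow> \<epsilon> < b \<Longrightarrow>
      \<exists>F. finite F \<and> F \<subseteq> X \<and> Y \<subseteq> (\<Union>x\<in>F. ball x \<epsilon>) \<and> card F \<le> \<epsilon> powr - s"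
    using upper_box_dim_less_imp_small_covers[OF s(1)] unfolding eventually_at_right_field by blast
  define r where "r = b / 2"
  have r: "0 < r" "r < b" using b(1) by (auto simp: r_def)
  define \<rho> :: "nat \<Rightarrow> real" where "\<rho> n = r * (1 / 2) ^ n" for n
  have "\<rho> n \<le> r" for n
    unfolding \<rho>_def using r by (intro mult_left_le power_le_one) auto
  then have "\<rho> n < b" for n
    using r(2) by (rule le_less_trans)
  moreover have "0 < \<rho> n" for n
    using r(1) by (simp add: \<rho>_def)
  ultimately have "\<forall>n. \<exists>F. finite F \<and> F \<subseteq> X \<and> Y \<subseteq> (\<Union>x\<in>F. ball x (\<rho> n)) \<and> card F \<le> \<rho> n powr - s"
    using b(2) by blast
  from choice[OF this] obtain F where F: "\<And>n. finite (F n)" "\<And>n. F n \<subseteq> X"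
    "\<And>n. Y \<subseteq> (\<Union>x\<in>F n. ball x (\<rho> n))" "\<And>n. card (F n) \<le> \<rho> n powr - s"
    by blast
  define G where "G n = {x \<in> F n. \<exists>y\<in>Y. dist x y < \<rho> n}" for n
  have "card (G n) \<le> r powr - s * (2 powr s) ^ n" for n
  proof -
    have "card (G n) \<le> card (F n)"
      by (rule card_mono[OF F(1)]) (auto simp: G_def)
    moreover have "\<rho> n powr - s = r powr - s * (2 powr s) ^ n"
    proof -
      have "(1 / 2 :: real) ^ n = 2 powr - real n"
        by (simp add: powr_minus powr_realpow power_divide inverse_eq_divide)
      then have "((1 / 2) ^ n) powr - s = (2 powr s) ^ n"
        by (simp add: powr_powr powr_power)
      then show ?thesis using r by (simp add: \<rho>_def powr_mult)
    qed
    ultimately show ?thesis using F(4)[of n] by linarith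
  qed
  moreover have "\<exists>x\<in>G n. dist x y < \<rho> n" if "y \<in> Y" for n y
    using F(3)[of n] that by (force simp: G_def)
  moreover have "finite (G n)" "G n \<subseteq> X" "\<forall>x\<in>G n. \<exists>y\<in>Y. dist x y < \<rho> n" for n
    using F(1,2)[of n] by (auto simp: G_def)
  ultimately have "0 < s \<and> s < d \<and> 0 < r \<and> (\<forall>n::nat. finite (G n) \<and> G n \<subseteq> X \<and>
      card (G n) \<le> r powr - s * (2 powr s) ^ n \<and> (\<forall>y\<in>Y. \<exists>x\<in>G n. dist x y < \<rho> n) \<and>
      (\<forall>x\<in>G n. \<exists>y\<in>Y. dist x y < \<rho> n))"
    using s r by blast
  then show ?thesis
    unfolding \<rho>_def by (intro exI[of _ s] exI[of _ r] exI[of _ "r powr - s"] exI[of _ G])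
qed

section \<open>The covering curve\<close>

theorem corollary1p3:
  fixes X Y :: "'a::metric_space set" and d :: real
  assumes "X \<noteq> {}" and "complete X" and "quasiconvex X"
    and "d \<ge> 1"
    and "Y \<subseteq> X" and "upper_box_dim X Y < ereal d"
  shows "\<exists>f. holder_curve (1 / d) X f \<and> Y \<subseteq> f ` {0..1}"
proof -
  have d: "0 < d" "0 < 1 / d" "1 / d \<le> 1" using \<open>d \<ge> 1\<close> by auto
  obtain x0 where x0: "x0 \<in> X" using \<open>X \<noteq> {}\<close> by blast
  obtain s r K G where s: "0 < s" "s < d" and r: "0 < r" and
    G: "\<And>n::nat. finite (G n)" "\<And>n. G n \<subseteq> X" "\<And>n. card (G n) \<le> K * (2 powr s) ^ n" and
    cover: "\<And>n y. y \<in> Y \<Longrightarrow> \<exists>x\<in>G n. dist x y < r * (1 / 2) ^ n" and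
    near: "\<And>n x. x \<in> G n \<Longrightarrow> \<exists>y\<in>Y. dist x y < r * (1 / 2) ^ n"
    using upper_box_dim_less_imp_nets[OF assms(6) d(1)] by metis
  \<comment> \<open>An arbitrary single point is put below the first net, so that the nets form one tree.\<close>
  define F where "F n = (case n of 0 \<Rightarrow> {x0} | Suc m \<Rightarrow> G m)" for n
  obtain R where R: "\<And>x. x \<in> G 0 \<Longrightarrow> dist x x0 \<le> R"
    using finite_imp_bounded[OF G(1)[of 0]] by (metis bounded_any_center dist_commute)
  \<comment> \<open>\<open>R\<close> serves the step from the root to the first net, \<open>4 * r\<close> all later steps.\<close>
  define B where "B = max (4 * r) R"
  have B: "4 * r \<le> B" "R \<le> B" "0 \<le> B" using r by (auto simp: B_def)
  have parent: "\<exists>x'\<in>F n. dist x x' \<le> B * (1 / 2) ^ n" if x: "x \<in> F (Suc n)" for n x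
  proof (cases n)
    case 0
    then show ?thesis using x R[of x] B by (simp add: F_def)
  next
    case (Suc m)
    obtain y where y: "y \<in> Y" "dist x y < r * (1 / 2) ^ Suc m"
      using near[of x "Suc m"] x Suc by (auto simp: F_def)
    obtain x' where x': "x' \<in> G m" "dist x' y < r * (1 / 2) ^ m"
      using cover[OF y(1)] by blast
    have "dist x x' \<le> dist x y + dist x' y" by metric
    also have "\<dots> \<le> r * (1 / 2) ^ m + r * (1 / 2) ^ m"
      using y(2) x'(2) r by (simp add: field_simps)
    also have "\<dots> = 4 * r * (1 / 2) ^ n" by (simp add: Suc)
    also have "\<dots> \<le> B * (1 / 2) ^ n" using B by (intro mult_right_mono) auto
    finally show ?thesis using x'(1) Suc by (auto simp: F_def)
  qed
  have finF: "finite (F n)" for n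
    using G(1) by (simp add: F_def split: nat.split)
  have cardF: "card (F n) \<le> max 1 K * (2 powr s) ^ n" for n
  proof (cases n)
    case (Suc m)
    have "card (F n) \<le> K * (2 powr s) ^ m"
      using G(3)[of m] by (simp add: F_def Suc)
    also have "\<dots> \<le> max 1 K * (2 powr s) ^ n"
      using s by (intro mult_mono power_increasing) (auto simp: Suc ge_one_powr_ge_zero)
    finally show ?thesis .
  qed (simp add: F_def)
  have "\<exists>(E :: real set) f L. E \<noteq> {} \<and> bounded E \<and> 0 \<le> L \<and> f ` E = (\<Union>n. F n) \<and>
      (\<forall>s\<in>E. \<forall>t\<in>E. dist (f s) (f t) \<le> L * dist s t powr (1 / d))"
  proof (rule nets_holder_parametrization)
    show "F 0 = {x0}" by (simp add: F_def)
  qed (fact finF cardF s(2) d(1) B(3) parent)+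
  then obtain E :: "real set" and f L where E: "E \<noteq> {}" "bounded E" and L: "0 \<le> L" and
    fE: "f ` E = (\<Union>n. F n)" and
    hold: "\<And>s t. s \<in> E \<Longrightarrow> t \<in> E \<Longrightarrow> dist (f s) (f t) \<le> L * dist s t powr (1 / d)"
    by blast
  have "f x \<in> X" if "x \<in> E" for x
  proof -
    have "F n \<subseteq> X" for n
      using G(2) x0 by (auto simp: F_def split: nat.split)
    then show ?thesis using fE that by blast
  qed
  then have "\<exists>h. holder_curve (1 / d) X h \<and> f ` E \<subseteq> h ` {0..1}"
    by (intro partial_holder_curve_extends[OF assms(2,3) E d(2,3) L _ hold])
  then obtain h where h: "holder_curve (1 / d) X h" "f ` E \<subseteq> h ` {0..1}" by blast
  obtain M where "0 \<le> M"
    "\<And>s t. s \<in> {0..1} \<Longrightarrow> t \<in> {0..1} \<Longrightarrow> dist (h s) (h t) \<le> M * dist s t powr (1 / d)"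
    using h(1) unfolding holder_curve_def holder_on_def by blast
  \<comment> \<open>The curve passes through all net points, which accumulate at every point of \<open>Y\<close>; as a compact
      set its image contains their limits.\<close>
  then have "continuous_on {0..1} h"
    by (intro uniformly_continuous_imp_continuous holder_imp_uniformly_continuous_on[OF d(2)])
  then have closed: "closed (h ` {0..1})"
    by (intro compact_imp_closed compact_continuous_image) auto
  have "y \<in> closure (f ` E)" if "y \<in> Y" for y
    unfolding closure_approachable
  proof (intro allI impI)
    fix e :: real
    assume "0 < e"
    then obtain n where n: "(1 / 2) ^ n < e / r"
      using real_arch_pow_inv[of "e / r" "1 / 2"] r by auto
    obtain x where x: "x \<in> G n" "dist x y < r * (1 / 2) ^ n"
      using cover[OF \<open>y \<in> Y\<close>] by blast
    have "r * (1 / 2) ^ n < e"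
      using n r by (simp add: pos_less_divide_eq mult.commute)
    then have "dist x y < e"
      using x(2) by linarith
    moreover have "x \<in> f ` E"
      unfolding fE using x(1) by (auto simp: F_def intro: exI[of _ "Suc n"])
    ultimately show "\<exists>x\<in>f ` E. dist x y < e" by blast
  qed
  then have "Y \<subseteq> h ` {0..1}"
    using closure_minimal[OF h(2) closed] by blast
  with h(1) show ?thesis by blast
qed

end
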